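(* For simple graphs $H,K$ on $[n]$ and every vertex $i\in[n]$, \[ |\{j\in[n]:(A(H)A(K))_{ij}>0\}|\le \sum_{w\in N_H(i)}d_K(w)\le d_H(i)\,\Delta(K). \]
   Context: $[n]=\{1,\dots,n\}$. Graphs are simple and undirected; $A(H)$ is the adjacency matrix, $N_H(i)$ the neighbourhood of $i$ in $H$, $d_H(i)$ the degree of $i$ in $H$, and $\Delta(K)$ the maximum degree of $K$. *)

theory Defs
  imports "Graph_Theory.Pair_Digraph" "Jordan_Normal_Form.Matrix"
begin

text \<open>A simple undirected graph is a finite symmetric loop-free digraph whose arcs are pairs of
  vertices: the edge between \<open>u\<close> and \<open>v\<close> is the pair of arcs \<open>(u, v)\<close>, \<open>(v, u)\<close>.\<close>

definition simple_graph_on :: "nat \<Rightarrow> nat pair_pre_digraph \<Rightarrow> bool" where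
  "simple_graph_on n G \<longleftrightarrow> pair_graph G \<and> pverts G = {1..n}"

definition nbhd :: "'a pair_pre_digraph \<Rightarrow> 'a \<Rightarrow> 'a set" where
  "nbhd G v = {w. (v, w) \<in> parcs G}"

text \<open>Exactly one of the two arcs of each edge at \<open>v\<close> leaves \<open>v\<close>, so the out-degree counts
  every edge at \<open>v\<close> once.\<close>

definition vertex_degree :: "'a pair_pre_digraph \<Rightarrow> 'a \<Rightarrow> nat" where
  "vertex_degree G v = out_degree (with_proj G) v"

lemma vertex_degree_eq_card_nbhd: "vertex_degree G v = card (nbhd G v)"
proof -
  have "out_arcs (with_proj G) v = Pair v ` nbhd G v"
    by (auto simp: out_arcs_def nbhd_def)
  then show ?thesis
    by (simp add: vertex_degree_def out_degree_def card_image inj_on_def)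
qed

definition max_degree :: "'a pair_pre_digraph \<Rightarrow> nat" where
  "max_degree G = Max (vertex_degree G ` pverts G)"

text \<open>Matrix indices start at 0, vertices at 1: vertex \<open>i\<close> belongs to row and column \<open>i - 1\<close>.\<close>

definition adjacency_matrix :: "nat \<Rightarrow> nat pair_pre_digraph \<Rightarrow> real mat" where
  "adjacency_matrix n G = mat n n (\<lambda>(r, c). if (Suc r, Suc c) \<in> parcs G then 1 else 0)"

definition entry :: "real mat \<Rightarrow> nat \<Rightarrow> nat \<Rightarrow> real" where
  "entry M i j = M $$ (i - 1, j - 1)"

end

theory Submission
  imports Defs
begin

text \<open>A positive entry of a product of two matrices needs a nonzero summand. For adjacency
  matrices a nonzero summand of the \<open>(i, j)\<close> entry of \<open>A(H) A(K)\<close> is a walk \<open>i, w, j\<close> whose first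
  step is an edge of \<open>H\<close> and whose second step is an edge of \<open>K\<close>. So every column \<open>j\<close> counted on
  the left lies in the union of the sets \<open>N\<^sub>K(w)\<close> over \<open>w \<in> N\<^sub>H(i)\<close>. The union bound gives the
  first inequality. Replacing each of the \<open>d\<^sub>H(i)\<close> summands by the maximum degree of \<open>K\<close> gives the
  second.\<close>

lemma nbhd_subset_verts:
  assumes "simple_graph_on n G"
  shows "nbhd G v \<subseteq> {1..n}"
proof -
  interpret pair_graph G
    using assms by (simp add: simple_graph_on_def)
  show ?thesis
    using in_arcsD2 assms by (auto simp: nbhd_def simple_graph_on_def)
qed

lemma finite_nbhd:
  assumes "simple_graph_on n G"
  shows "finite (nbhd G v)"
  using nbhd_subset_verts[OF assms] by (rule finite_subset) simp

lemma vertex_degree_le_max_degree: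
  assumes "simple_graph_on n G" and "v \<in> {1..n}"
  shows "vertex_degree G v \<le> max_degree G"
  using assms by (simp add: max_degree_def simple_graph_on_def)

text \<open>The entry is a sum over the possible middle vertices of a walk of length 2 from \<open>i\<close> to \<open>j\<close>,
  and the summand of a middle vertex is 0 unless both steps are edges.\<close>

lemma adjacency_product_pos_imp_walk:
  assumes "i \<in> {1..n}" and "j \<in> {1..n}"
    and pos: "entry (adjacency_matrix n H * adjacency_matrix n K) i j > 0"
  shows "\<exists>w. w \<in> nbhd H i \<and> j \<in> nbhd K w"
proof -
  \<comment> \<open>Matrix positions start at 0, so the summation index \<open>k\<close> stands for the vertex \<open>Suc k\<close>.\<close>
  have "entry (adjacency_matrix n H * adjacency_matrix n K) i j =
      (\<Sum>k = 0..<n. (if (i, Suc k) \<in> parcs H then 1 else 0) *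
                    (if (Suc k, j) \<in> parcs K then 1 else 0))"
    using assms(1,2) by (auto simp: entry_def adjacency_matrix_def scalar_prod_def)
  with pos obtain k where "(if (i, Suc k) \<in> parcs H then 1 else (0::real)) *
                    (if (Suc k, j) \<in> parcs K then 1 else 0) \<noteq> 0"
    by (metis (no_types, lifting) less_irrefl sum.neutral)
  then have "Suc k \<in> nbhd H i \<and> j \<in> nbhd K (Suc k)"
    by (auto simp: nbhd_def split: if_splits)
  then show ?thesis ..
qed

theorem lemma5:
  fixes n i :: nat and H K :: "nat pair_pre_digraph"
  assumes "simple_graph_on n H" and "simple_graph_on n K" and "i \<in> {1..n}"
  shows "card {j \<in> {1..n}. entry (adjacency_matrix n H * adjacency_matrix n K) i j > 0}
           \<le> (\<Sum>w\<in>nbhd H i. vertex_degree K w)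
       \<and> (\<Sum>w\<in>nbhd H i. vertex_degree K w) \<le> vertex_degree H i * max_degree K"
proof
  let ?S = "{j \<in> {1..n}. entry (adjacency_matrix n H * adjacency_matrix n K) i j > 0}"
  have "?S \<subseteq> (\<Union>w\<in>nbhd H i. nbhd K w)"
    using adjacency_product_pos_imp_walk[OF assms(3)] by blast
  then have "card ?S \<le> card (\<Union>w\<in>nbhd H i. nbhd K w)"
    using finite_nbhd[OF assms(1)] finite_nbhd[OF assms(2)] by (intro card_mono) auto
  also have "\<dots> \<le> (\<Sum>w\<in>nbhd H i. card (nbhd K w))"
    by (rule card_UN_le[OF finite_nbhd[OF assms(1)]])
  finally show "card ?S \<le> (\<Sum>w\<in>nbhd H i. vertex_degree K w)"
    by (simp only: vertex_degree_eq_card_nbhd)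
next
  have "vertex_degree K w \<le> max_degree K" if "w \<in> nbhd H i" for w
    using that nbhd_subset_verts[OF assms(1)] vertex_degree_le_max_degree[OF assms(2)] by blast
  then have "(\<Sum>w\<in>nbhd H i. vertex_degree K w) \<le> card (nbhd H i) * max_degree K"
    using sum_bounded_above[of "nbhd H i" "vertex_degree K" "max_degree K"] by simp
  then show "(\<Sum>w\<in>nbhd H i. vertex_degree K w) \<le> vertex_degree H i * max_degree K"
    by (simp only: vertex_degree_eq_card_nbhd)
qed

end
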